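(* Let $\tau\ge 0$ and let $\mathbf{L}\in\mathbb{R}^{n\times n}$ be the combinatorial Laplacian of an undirected graph on $n$ nodes with nonnegative edge weights, with largest eigenvalue $\lambda_{\max}=2$. Let $x\in\mathbb{R}^n$ be such that $a_1 := \sum_{i=1}^n x_i \ne 0$. Let $K\ge 0$ be an integer with $K>\tau/2-1$, and let $p_K$ be the order-$K$ truncated Chebyshev approximation of $\lambda\mapsto\exp(-\tau\lambda)$ on $[0,2]$. Set $$\epsilon_K(x) := \frac{\|\exp(-\tau\mathbf{L})x - p_K(\mathbf{L})x\|_2^2}{\|x\|_2^2},\qquad \eta_K(x) := \frac{\|\exp(-\tau\mathbf{L})x - p_K(\mathbf{L})x\|_2^2}{\|\exp(-\tau\mathbf{L})x\|_2^2}.$$ Then $$\eta_K(x) \ \le\ \epsilon_K(x)\,\frac{\|x\|_2^2}{a_1^2/n} \ \le\ g^2(K,\tau)\,\frac{n\,\|x\|_2^2}{a_1^2},$$ where $$g(K,\tau) := 2\, e^{\frac{(\tau/2)^2}{K+2}-\tau}\, \frac{(\tau/2)^{K+1}}{K!\,(K+1-\tau/2)}.$$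
   Context: The combinatorial Laplacian of an undirected graph with symmetric nonnegative weight matrix $W$ (zero diagonal) is $\mathbf{L}=D-W$, where $D$ is the diagonal matrix with $D_{ii}=\sum_j W_{ij}$. The polynomial $p_K$ is $p_K(\lambda) = \tfrac12 c_0(\tau) + \sum_{k=1}^{K} c_k(\tau)\, T_k(\lambda-1)$, where $T_k$ is the Chebyshev polynomial of the first kind ($T_k(\cos\theta)=\cos(k\theta)$) and $c_k(\tau) = \frac{2}{\pi}\int_0^{\pi} \cos(k\theta) \exp(-\tau(\cos\theta+1))\,\mathrm{d}\theta$. For a symmetric matrix $\mathbf{L}=\mathbf{U}\,\mathrm{diag}(\lambda_i)\,\mathbf{U}^\top$ ($\mathbf{U}$ orthogonal) and a function $f$, $f(\mathbf{L}) := \mathbf{U}\,\mathrm{diag}(f(\lambda_i))\,\mathbf{U}^\top$, which agrees with the usual matrix polynomial and matrix exponential. *)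

theory Defs
  imports "HOL-Analysis.Analysis" "HOL-Computational_Algebra.Polynomial"
begin

definition weight_matrix :: "real^'n^'n \<Rightarrow> bool" where
  "weight_matrix W \<longleftrightarrow> transpose W = W \<and> (\<forall>i j. 0 \<le> W $ i $ j) \<and> (\<forall>i. W $ i $ i = 0)"

definition diag_matrix :: "('n \<Rightarrow> real) \<Rightarrow> real^'n^'n" where
  "diag_matrix d = (\<chi> i j. if i = j then d i else 0)"

definition laplacian :: "real^'n^'n \<Rightarrow> real^'n^'n" where
  "laplacian W = diag_matrix (\<lambda>i. \<Sum>j\<in>UNIV. W $ i $ j) - W"

definition eigenvalue_of :: "real^'n^'n \<Rightarrow> real \<Rightarrow> bool" where
  "eigenvalue_of A l \<longleftrightarrow> (\<exists>v. v \<noteq> 0 \<and> A *v v = l *\<^sub>R v)"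

definition largest_eigenvalue_of :: "real^'n^'n \<Rightarrow> real \<Rightarrow> bool" where
  "largest_eigenvalue_of A l \<longleftrightarrow> eigenvalue_of A l \<and> (\<forall>m. eigenvalue_of A m \<longrightarrow> m \<le> l)"

(* Meaningful for symmetric A, where a decomposition exists; the value does not depend on
   the decomposition chosen (matrix_function_eqI below). *)
definition matrix_function :: "(real \<Rightarrow> real) \<Rightarrow> real^'n^'n \<Rightarrow> real^'n^'n" where
  "matrix_function f A = (THE M. \<exists>U d. orthogonal_matrix U \<and>
     A = U ** diag_matrix d ** transpose U \<and>
     M = U ** diag_matrix (\<lambda>i. f (d i)) ** transpose U)"

lemma matrix_mul_diag_matrix: "(A ** diag_matrix d) $ i $ j = A $ i $ j * d j"
  by (simp add: matrix_matrix_mult_def diag_matrix_def mult_delta_right)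

lemma diag_matrix_mul_matrix: "(diag_matrix d ** A) $ i $ j = d i * A $ i $ j"
  by (simp add: matrix_matrix_mult_def diag_matrix_def mult_delta_left)

lemma matrix_function_unique:
  fixes U V :: "real^'n^'n"
  assumes U: "orthogonal_matrix U" and V: "orthogonal_matrix V"
    and eq: "U ** diag_matrix d ** transpose U = V ** diag_matrix e ** transpose V"
  shows "U ** diag_matrix (\<lambda>i. f (d i)) ** transpose U =
         V ** diag_matrix (\<lambda>i. f (e i)) ** transpose V"
proof -
  have U1: "transpose U ** U = mat 1" "U ** transpose U = mat 1"
    using U by (auto simp: orthogonal_matrix_def)
  have V1: "transpose V ** V = mat 1" "V ** transpose V = mat 1"
    using V by (auto simp: orthogonal_matrix_def)
  define W where "W = transpose V ** U"
  have "W ** diag_matrix d = transpose V ** (U ** diag_matrix d ** transpose U) ** U"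
    by (simp add: W_def U1(1) flip: matrix_mul_assoc)
  also have "\<dots> = diag_matrix e ** W"
    unfolding eq by (simp add: W_def V1(1) matrix_mul_assoc)
  finally have WD: "W ** diag_matrix d = diag_matrix e ** W" .
  have "W $ i $ j * d j = e i * W $ i $ j" for i j
    using arg_cong[OF WD, of "\<lambda>A. A $ i $ j"]
    by (simp only: matrix_mul_diag_matrix diag_matrix_mul_matrix)
  then have "W $ i $ j = 0 \<or> d j = e i" for i j
    by (metis mult.commute mult_cancel_left)
  then have "W $ i $ j * f (d j) = f (e i) * W $ i $ j" for i j
    by (metis mult.commute mult_zero_left)
  then have WF: "W ** diag_matrix (\<lambda>i. f (d i)) = diag_matrix (\<lambda>i. f (e i)) ** W"
    by (simp add: vec_eq_iff matrix_mul_diag_matrix diag_matrix_mul_matrix)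
  have "U ** diag_matrix (\<lambda>i. f (d i)) ** transpose U
        = V ** (W ** diag_matrix (\<lambda>i. f (d i))) ** transpose U"
    by (simp add: W_def V1(2) matrix_mul_assoc)
  also have "\<dots> = V ** diag_matrix (\<lambda>i. f (e i)) ** transpose V"
    unfolding WF by (simp add: W_def U1(2) flip: matrix_mul_assoc)
  finally show ?thesis .
qed

lemma matrix_function_eqI:
  assumes "orthogonal_matrix U" "A = U ** diag_matrix d ** transpose U"
  shows "matrix_function f A = U ** diag_matrix (\<lambda>i. f (d i)) ** transpose U"
  unfolding matrix_function_def
proof (rule the_equality)
  show "\<exists>V e. orthogonal_matrix V \<and> A = V ** diag_matrix e ** transpose V \<and>
    U ** diag_matrix (\<lambda>i. f (d i)) ** transpose U =
    V ** diag_matrix (\<lambda>i. f (e i)) ** transpose V"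
    using assms by blast
next
  fix M
  assume "\<exists>V e. orthogonal_matrix V \<and> A = V ** diag_matrix e ** transpose V \<and>
    M = V ** diag_matrix (\<lambda>i. f (e i)) ** transpose V"
  then obtain V e where V: "orthogonal_matrix V" "A = V ** diag_matrix e ** transpose V"
    and M: "M = V ** diag_matrix (\<lambda>i. f (e i)) ** transpose V"
    by blast
  have "V ** diag_matrix e ** transpose V = U ** diag_matrix d ** transpose U"
    using V(2) assms(2) by simp
  from matrix_function_unique[OF V(1) assms(1) this]
  show "M = U ** diag_matrix (\<lambda>i. f (d i)) ** transpose U"
    unfolding M .
qed

definition chebyshev_poly :: "nat \<Rightarrow> real poly" where
  "chebyshev_poly k = (THE p. \<forall>\<theta>. poly p (cos \<theta>) = cos (real k * \<theta>))"

lemma chebyshev_poly_exists: "\<exists>p :: real poly. \<forall>\<theta>. poly p (cos \<theta>) = cos (real k * \<theta>)"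
proof (induction k rule: less_induct)
  case (less k)
  consider "k = 0" | "k = 1" | m where "k = Suc (Suc m)"
    by (cases k; cases "k - 1") auto
  then show ?case
  proof cases
    case 1
    then show ?thesis by (intro exI[of _ 1]) simp
  next
    case 2
    then show ?thesis by (intro exI[of _ "[:0, 1:]"]) simp
  next
    case 3
    have "Suc m < k" "m < k"
      using 3 by simp_all
    from less.IH[OF this(1)] obtain p :: "real poly"
      where p: "\<forall>\<theta>. poly p (cos \<theta>) = cos (real (Suc m) * \<theta>)" by blast
    from less.IH[OF \<open>m < k\<close>] obtain q :: "real poly"
      where q: "\<forall>\<theta>. poly q (cos \<theta>) = cos (real m * \<theta>)" by blast
    have "poly ([:0, 2:] * p - q) (cos \<theta>) = cos (real k * \<theta>)" for \<theta>
    proof -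
      define s where "s = real (Suc m) * \<theta>"
      have a: "real k * \<theta> = s + \<theta>" "real m * \<theta> = s - \<theta>"
        using 3 by (simp_all add: s_def algebra_simps)
      have "poly ([:0, 2:] * p - q) (cos \<theta>) = 2 * cos \<theta> * cos s - cos (s - \<theta>)"
        by (simp add: p[rule_format, of \<theta>, folded s_def] q[rule_format, of \<theta>, unfolded a(2)])
      also have "\<dots> = cos (s + \<theta>)"
        by (simp add: cos_add cos_diff)
      finally show ?thesis unfolding a(1) .
    qed
    then show ?thesis by (intro exI allI)
  qed
qed

lemma poly_chebyshev_poly_cos: "poly (chebyshev_poly k) (cos \<theta>) = cos (real k * \<theta>)"
proof -
  obtain p :: "real poly" where p: "\<forall>\<theta>. poly p (cos \<theta>) = cos (real k * \<theta>)"
    using chebyshev_poly_exists by blast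
  have "q = p" if q: "\<forall>\<theta>. poly q (cos \<theta>) = cos (real k * \<theta>)" for q
  proof (rule ccontr)
    assume "q \<noteq> p"
    then have "finite {x. poly (q - p) x = 0}" by (intro poly_roots_finite) simp
    moreover have "{-1..1} \<subseteq> {x. poly (q - p) x = 0}"
    proof
      fix x :: real assume "x \<in> {-1..1}"
      then have "cos (arccos x) = x" by simp
      moreover have "poly (q - p) (cos (arccos x)) = 0"
        using p q by (simp only: poly_diff)
      ultimately show "x \<in> {x. poly (q - p) x = 0}" by simp
    qed
    ultimately have "finite {-1..1::real}" by (rule rev_finite_subset)
    then show False using infinite_Icc[of "-1::real" 1] by simp
  qed
  then have "chebyshev_poly k = p"
    unfolding chebyshev_poly_def using p by (intro the_equality)
  then show ?thesis using p by (simp only:)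
qed

definition cheb_coeff :: "real \<Rightarrow> nat \<Rightarrow> real" where
  "cheb_coeff \<tau> k =
     2 / pi * integral {0..pi} (\<lambda>\<theta>. cos (real k * \<theta>) * exp (- \<tau> * (cos \<theta> + 1)))"

definition cheb_approx :: "nat \<Rightarrow> real \<Rightarrow> real \<Rightarrow> real" where
  "cheb_approx K \<tau> t = cheb_coeff \<tau> 0 / 2 +
     (\<Sum>k=1..K. cheb_coeff \<tau> k * poly (chebyshev_poly k) (t - 1))"

definition exact_diffusion :: "real \<Rightarrow> real^'n^'n \<Rightarrow> real^'n \<Rightarrow> real^'n" where
  "exact_diffusion \<tau> L x = matrix_function (\<lambda>t. exp (- \<tau> * t)) L *v x"

definition approx_diffusion :: "nat \<Rightarrow> real \<Rightarrow> real^'n^'n \<Rightarrow> real^'n \<Rightarrow> real^'n" where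
  "approx_diffusion K \<tau> L x = matrix_function (cheb_approx K \<tau>) L *v x"

definition err_input :: "nat \<Rightarrow> real \<Rightarrow> real^'n^'n \<Rightarrow> real^'n \<Rightarrow> real" where
  "err_input K \<tau> L x =
     (norm (exact_diffusion \<tau> L x - approx_diffusion K \<tau> L x))\<^sup>2 / (norm x)\<^sup>2"

definition err_output :: "nat \<Rightarrow> real \<Rightarrow> real^'n^'n \<Rightarrow> real^'n \<Rightarrow> real" where
  "err_output K \<tau> L x =
     (norm (exact_diffusion \<tau> L x - approx_diffusion K \<tau> L x))\<^sup>2 /
     (norm (exact_diffusion \<tau> L x))\<^sup>2"

definition g_bound :: "nat \<Rightarrow> real \<Rightarrow> real" where
  "g_bound K \<tau> = 2 * exp ((\<tau> / 2)\<^sup>2 / (real K + 2) - \<tau>) *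
     ((\<tau> / 2) ^ (K + 1) / (fact K * (real K + 1 - \<tau> / 2)))"

end

(* Jacobi-Anger: exp (2 h cos t) = I_0 + 2 * (SUM k>=1. I_k cos (k t)) with I_k the modified
   Bessel function at 2 h, so that c_k = 2 exp (-tau) I_k(-tau).  The factorial bound
   |I_k| <= |h|^k / k! * exp (h^2 / (k + 1)) and a geometric series then bound the truncation
   error on [0, 2] uniformly by g.  Diagonalization carries this over to the matrix functions.
   Since L annihilates constants and is symmetric, exp (-tau L) preserves the sum a1 of the entries,
   and Cauchy-Schwarz gives norm (exp (-tau L) x)^2 >= a1^2 / n. *)
theory Submission
  imports Defs
begin

section \<open>Modified Bessel functions and the Chebyshev error\<close>

(* Taken at half the usual argument: bessel_I k h is I_k(2 h). *)
definition bessel_I :: "nat \<Rightarrow> real \<Rightarrow> real" where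
  "bessel_I k h = (\<Sum>m. h ^ (2 * m + k) / (fact m * fact (m + k)))"

section \<open>Growth bounds and summability of the Bessel series\<close>

text \<open>Each of the \<open>m\<close> factors \<open>k + 1, ..., k + m\<close> of
  \<open>(m + k)! / k!\<close> is at least \<open>k + 1\<close>.\<close>

lemma fact_mult_power_le_fact_add: "fact k * (real k + 1) ^ m \<le> (fact (m + k) :: real)"
proof (induction m)
  case (Suc m)
  have "fact k * (real k + 1) ^ Suc m = (real k + 1) * (fact k * (real k + 1) ^ m)"
    by simp
  also have "\<dots> \<le> (real (m + k) + 1) * fact (m + k)"
    by (intro mult_mono Suc) auto
  finally show ?case by (simp add: add_ac)
qed simp

text \<open>The majorant is a multiple of the exponential series at \<open>h^2 / (k + 1)\<close>, so
  summing over \<open>m\<close> bounds \<open>bessel_I\<close> in closed form.\<close>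

lemma bessel_I_term_le:
  "\<bar>h ^ (2 * m + k) / (fact m * fact (m + k))\<bar>
     \<le> \<bar>h\<bar> ^ k / fact k * ((h\<^sup>2 / (real k + 1)) ^ m /\<^sub>R fact m)"
proof -
  have "\<bar>h ^ (2 * m + k) / (fact m * fact (m + k))\<bar> = \<bar>h\<bar> ^ (2 * m + k) / (fact m * fact (m + k))"
    by (simp add: power_abs)
  also have "\<dots> \<le> \<bar>h\<bar> ^ (2 * m + k) / (fact m * (fact k * (real k + 1) ^ m))"
    by (intro divide_left_mono mult_left_mono fact_mult_power_le_fact_add) auto
  also have "\<bar>h\<bar> ^ (2 * m + k) = (h\<^sup>2) ^ m * \<bar>h\<bar> ^ k"
    by (simp add: power_add power_mult)
  also have "\<dots> / (fact m * (fact k * (real k + 1) ^ m))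
      = \<bar>h\<bar> ^ k / fact k * ((h\<^sup>2 / (real k + 1)) ^ m /\<^sub>R fact m)"
    by (simp add: power_divide) (simp add: divide_inverse)
  finally show ?thesis .
qed

lemma
  shows summable_abs_bessel_I_terms:
      "summable (\<lambda>m. \<bar>h ^ (2 * m + k) / (fact m * fact (m + k))\<bar>)"
    and abs_bessel_I_le: "\<bar>bessel_I k h\<bar> \<le> \<bar>h\<bar> ^ k / fact k * exp (h\<^sup>2 / (real k + 1))"
proof -
  have s: "(\<lambda>m. \<bar>h\<bar> ^ k / fact k * ((h\<^sup>2 / (real k + 1)) ^ m /\<^sub>R fact m))
      sums (\<bar>h\<bar> ^ k / fact k * exp (h\<^sup>2 / (real k + 1)))"
    by (intro sums_mult exp_converges)
  show *: "summable (\<lambda>m. \<bar>h ^ (2 * m + k) / (fact m * fact (m + k))\<bar>)"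
    by (rule summable_comparison_test'[OF sums_summable[OF s], of 0]) (use bessel_I_term_le in auto)
  have "\<bar>bessel_I k h\<bar> \<le> (\<Sum>m. \<bar>h ^ (2 * m + k) / (fact m * fact (m + k))\<bar>)"
    unfolding bessel_I_def by (rule summable_rabs[OF *])
  also have "\<dots> \<le> \<bar>h\<bar> ^ k / fact k * exp (h\<^sup>2 / (real k + 1))"
    using suminf_le[OF bessel_I_term_le * sums_summable[OF s]] sums_unique[OF s] by simp
  finally show "\<bar>bessel_I k h\<bar> \<le> \<bar>h\<bar> ^ k / fact k * exp (h\<^sup>2 / (real k + 1))" .
qed

lemma bessel_I_has_sum:
  "((\<lambda>m. h ^ (2 * m + k) / (fact m * fact (m + k))) has_sum bessel_I k h) UNIV"
  unfolding bessel_I_def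
  using summable_abs_bessel_I_terms[of h k]
    summable_sums[OF summable_rabs_cancel[OF summable_abs_bessel_I_terms[of h k]]]
  by (intro norm_summable_imp_has_sum) simp_all

text \<open>Supplies the Weierstrass majorant for integrating the Jacobi-Anger series term by
  term.\<close>

lemma summable_abs_bessel_I: "summable (\<lambda>k. \<bar>bessel_I k h\<bar>)"
proof (rule summable_comparison_test')
  show "summable (\<lambda>k. exp (h\<^sup>2) * (\<bar>h\<bar> ^ k /\<^sub>R fact k))"
    by (intro summable_mult summable_exp_generic)
  fix k :: nat
  have "h\<^sup>2 / (real k + 1) \<le> h\<^sup>2 / 1"
    by (intro divide_left_mono) auto
  then have "\<bar>h\<bar> ^ k / fact k * exp (h\<^sup>2 / (real k + 1)) \<le> \<bar>h\<bar> ^ k / fact k * exp (h\<^sup>2)"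
    by (intro mult_left_mono) auto
  also have "\<dots> = exp (h\<^sup>2) * (\<bar>h\<bar> ^ k /\<^sub>R fact k)"
    by (simp add: divide_inverse)
  finally show "norm \<bar>bessel_I k h\<bar> \<le> exp (h\<^sup>2) * (\<bar>h\<bar> ^ k /\<^sub>R fact k)"
    using abs_bessel_I_le[of k h] by simp
qed

section \<open>Jacobi-Anger expansion\<close>

text \<open>Absolute summability gives an unordered sum over all pairs, which can later be grouped
  by the difference \<open>i - j\<close> instead of the usual Cauchy diagonals
  \<open>i + j\<close>.\<close>

lemma has_sum_times_product:
  fixes f g :: "nat \<Rightarrow> 'a :: {banach, real_normed_div_algebra}"
  assumes "summable (\<lambda>n. norm (f n))" "summable (\<lambda>n. norm (g n))" "f sums a" "g sums b"
  shows "((\<lambda>(i, j). f i * g j) has_sum (a * b)) UNIV"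
proof -
  have f: "(f has_sum a) UNIV" and g: "(g has_sum b) UNIV"
    using assms by (auto intro: norm_summable_imp_has_sum)
  have nf: "(\<lambda>n. norm (f n)) summable_on UNIV"
    using assms(1) by (intro norm_summable_imp_summable_on) simp
  have ng: "((\<lambda>n. norm (g n)) has_sum (\<Sum>n. norm (g n))) UNIV"
    using assms(2) by (intro norm_summable_imp_has_sum summable_sums) auto
  have "(\<lambda>(i, j). norm (f i) * norm (g j)) summable_on UNIV \<times> UNIV"
    by (rule summable_on_SigmaI[where g = "\<lambda>i. norm (f i) * (\<Sum>n. norm (g n))"])
       (simp_all add: has_sum_cmult_right[OF ng] summable_on_cmult_left[OF nf])
  then have "(\<lambda>(i, j). f i * g j) summable_on UNIV \<times> UNIV"
    using abs_summable_summable[of "\<lambda>(i, j). f i * g j"]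
    by (simp add: case_prod_unfold norm_mult)
  then have "((\<lambda>(i, j). f i * g j) has_sum (a * b)) (UNIV \<times> UNIV)"
    by (intro has_sum_SigmaI[where g = "\<lambda>i. f i * b"])
       (simp_all add: has_sum_cmult_right[OF g] has_sum_cmult_left[OF f])
  then show ?thesis by simp
qed

text \<open>For \<open>z = h * cis \<theta>\<close> one has
  \<open>z + cnj z = 2 * h * cos \<theta>\<close>; the family is the real part of the product of the
  exponential series of \<open>z\<close> and \<open>cnj z\<close>.\<close>

lemma exp_cos_double_series:
  "((\<lambda>(i, j). h ^ (i + j) / (fact i * fact j) * cos ((real i - real j) * \<theta>))
     has_sum exp (2 * h * cos \<theta>)) UNIV"
proof -
  define z where "z = of_real h * cis \<theta>"
  have "((\<lambda>(i, j). (z ^ i /\<^sub>R fact i) * (cnj z ^ j /\<^sub>R fact j)) has_sum (exp z * exp (cnj z))) UNIV"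
    by (intro has_sum_times_product summable_norm_exp exp_converges)
  then have "((\<lambda>p. Re (case p of (i, j) \<Rightarrow> (z ^ i /\<^sub>R fact i) * (cnj z ^ j /\<^sub>R fact j)))
      has_sum Re (exp z * exp (cnj z))) UNIV"
    by (rule has_sum_Re)
  moreover have "Re (exp z * exp (cnj z)) = exp (2 * h * cos \<theta>)"
  proof -
    have "z + cnj z = of_real (2 * h * cos \<theta>)"
      by (simp add: z_def complex_eq_iff)
    then show ?thesis by (simp only: exp_add[symmetric] exp_of_real Re_complex_of_real)
  qed
  moreover have "Re ((z ^ i /\<^sub>R fact i) * (cnj z ^ j /\<^sub>R fact j))
      = h ^ (i + j) / (fact i * fact j) * cos ((real i - real j) * \<theta>)" for i j
  proof -
    have "z ^ i * cnj z ^ j = of_real (h ^ (i + j)) * cis ((real i - real j) * \<theta>)"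
      by (simp add: z_def power_mult_distrib Complex.DeMoivre cis_cnj cis_mult power_add algebra_simps)
    then have *: "Re (z ^ i * cnj z ^ j) = h ^ (i + j) * cos ((real i - real j) * \<theta>)"
      by simp
    have "(z ^ i /\<^sub>R fact i) * (cnj z ^ j /\<^sub>R fact j) = (z ^ i * cnj z ^ j) /\<^sub>R (fact i * fact j)"
      by simp
    then show ?thesis by (simp only: scaleR_complex.sel *) (simp add: divide_inverse)
  qed
  ultimately show ?thesis by (simp add: case_prod_unfold)
qed

text \<open>The pairs with \<open>i - j = k\<close> and, by symmetry, those with
  \<open>j - i = k\<close> each contribute \<open>g k\<close>. The two sets coincide only for
  \<open>k = 0\<close>, hence weight 1 there and 2 elsewhere.\<close>

lemma has_sum_symmetric_imp_sums_by_difference: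
  fixes f :: "nat \<times> nat \<Rightarrow> real"
  assumes f: "(f has_sum S) UNIV" and sym: "\<And>i j. f (i, j) = f (j, i)"
    and g: "\<And>k. ((\<lambda>m. f (m + k, m)) has_sum g k) UNIV"
  shows "(\<lambda>k. (if k = 0 then 1 else 2) * g k) sums S"
proof -
  define A where "A = {(i, j). j \<le> (i::nat)}"
  define B where "B = {(i, j). i < (j::nat)}"
  have AB: "A \<inter> B = {}" "A \<union> B = UNIV" by (auto simp: A_def B_def)
  have fs: "f summable_on C" for C
    using f summable_on_subset_banach[of f UNIV C] by (auto simp: summable_on_def)
  have a: "(f has_sum infsum f A) A" and b: "(f has_sum infsum f B) B"
    using fs by auto
  have "((\<lambda>(k, m). f (m + k, m)) has_sum infsum f A) (UNIV \<times> UNIV)"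
    using a by (subst has_sum_reindex_bij_witness[where h = f and T = A
        and i = "\<lambda>(i, j). (i - j, j)" and j = "\<lambda>(k, m). (m + k, m)"]) (auto simp: A_def)
  from has_sum_SigmaD[OF this, of g] g have ga: "(g has_sum infsum f A) UNIV"
    by simp
  \<comment> \<open>The diagonal already belongs to \<open>A\<close>, so the differences in
    \<open>B\<close> start at 1.\<close>
  have "((\<lambda>(k, m). f (m + Suc k, m)) has_sum infsum f B) (UNIV \<times> UNIV)"
    using b by (subst has_sum_reindex_bij_witness[where h = f and T = B
        and i = "\<lambda>(i, j). (j - Suc i, i)" and j = "\<lambda>(k, m). (m, m + Suc k)"])
      (auto simp: B_def intro: sym)
  from has_sum_SigmaD[OF this, of "\<lambda>k. g (Suc k)"] g[of "Suc _"]
  have gb: "((\<lambda>k. g (Suc k)) has_sum infsum f B) UNIV"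
    by simp
  have "(f has_sum (infsum f A + infsum f B)) UNIV"
    using has_sum_Un_disjoint[OF a b AB(1)] AB(2) by simp
  then have S: "S = infsum f A + infsum f B" using f has_sum_unique by blast
  have "(\<lambda>k. if k = 0 then 0 else g k) sums infsum f B"
    using sums_Suc[of "\<lambda>k. if k = 0 then 0 else g k"] has_sum_imp_sums[OF gb] by simp
  from sums_add[OF has_sum_imp_sums[OF ga] this] show ?thesis
    unfolding S by (rule sums_cong[THEN iffD1, rotated]) auto
qed

text \<open>On the pairs \<open>(m + k, m)\<close> the cosine is constantly
  \<open>cos (k * \<theta>)\<close> and the coefficients are the terms of
  \<open>bessel_I k h\<close>.\<close>

lemma jacobi_anger:
  "(\<lambda>k. (if k = 0 then 1 else 2) * (bessel_I k h * cos (real k * \<theta>))) sums exp (2 * h * cos \<theta>)"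
proof (rule has_sum_symmetric_imp_sums_by_difference[OF exp_cos_double_series])
  show "(case (i, j) of (i, j) \<Rightarrow> h ^ (i + j) / (fact i * fact j) * cos ((real i - real j) * \<theta>))
      = (case (j, i) of (i, j) \<Rightarrow> h ^ (i + j) / (fact i * fact j) * cos ((real i - real j) * \<theta>))"
    for i j
  proof -
    have "cos ((real i - real j) * \<theta>) = cos ((real j - real i) * \<theta>)"
      by (metis cos_minus minus_diff_eq mult_minus_left)
    then show ?thesis by (simp add: add.commute mult.commute)
  qed
  have "(case (m + k, m) of (i, j) \<Rightarrow>
      h ^ (i + j) / (fact i * fact j) * cos ((real i - real j) * \<theta>))
      = h ^ (2 * m + k) / (fact m * fact (m + k)) * cos (real k * \<theta>)" for m k
    by (simp add: mult_2 add_ac mult.commute[of "fact m"])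
  then show "((\<lambda>m. case (m + k, m) of (i, j) \<Rightarrow>
      h ^ (i + j) / (fact i * fact j) * cos ((real i - real j) * \<theta>))
      has_sum bessel_I k h * cos (real k * \<theta>)) UNIV" for k
    using has_sum_cmult_left[OF bessel_I_has_sum[of h k], of "cos (real k * \<theta>)"]
    by simp
qed

section \<open>Chebyshev coefficients as Bessel functions\<close>

lemma has_integral_cos_mult:
  assumes "c \<noteq> 0" "sin (c * pi) = 0"
  shows "((\<lambda>t. cos (c * t)) has_integral 0) {0..pi}"
proof -
  have "((\<lambda>t. cos (c * t)) has_integral (sin (c * pi) / c - sin (c * 0) / c)) {0..pi}"
    by (rule fundamental_theorem_of_calculus)
       (use assms(1) in \<open>auto intro!: derivative_eq_intros
          simp flip: has_real_derivative_iff_has_vector_derivative\<close>)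
  then show ?thesis using assms by simp
qed

lemma has_integral_cos_cos:
  "((\<lambda>t. cos (real j * t) * cos (real k * t)) has_integral
     (if j = k then (if k = 0 then pi else pi / 2) else 0)) {0..pi}"
proof -
  \<comment> \<open>Frequencies are taken in \<open>int\<close> because \<open>j - k\<close> may be
    negative.\<close>
  have c: "((\<lambda>t. cos (of_int n * t)) has_integral (if n = 0 then pi else 0)) {0..pi}" for n :: int
  proof (cases "n = 0")
    case True
    then show ?thesis using has_integral_const_real[of "1::real" 0 pi] by simp
  next
    case False
    then show ?thesis using has_integral_cos_mult[of "of_int n"] sin_times_pi_eq_0
      by auto
  qed
  have "((\<lambda>t. (cos (of_int (int j - int k) * t) + cos (of_int (int j + int k) * t)) / 2)
     has_integral ((if int j - int k = 0 then pi else 0) + (if int j + int k = 0 then pi else 0)) / 2) {0..pi}"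
    by (intro has_integral_divide has_integral_add c)
  also have "(\<lambda>t. (cos (of_int (int j - int k) * t) + cos (of_int (int j + int k) * t)) / 2)
      = (\<lambda>t. cos (real j * t) * cos (real k * t))"
    by (simp add: cos_times_cos left_diff_distrib distrib_right)
  finally show ?thesis by (rule has_integral_eq_rhs) auto
qed

text \<open>The Jacobi-Anger series at \<open>- \<tau> / 2\<close> converges uniformly in \<theta>,
  so it can be multiplied by \<open>cos (k * \<theta>)\<close> and integrated termwise;
  orthogonality isolates order \<open>k\<close>.\<close>

lemma cheb_coeff_eq: "cheb_coeff \<tau> k = 2 * exp (-\<tau>) * bessel_I k (- \<tau> / 2)"
proof -
  define b where "b j = (if j = 0 then 1 else 2) * bessel_I j (- \<tau> / 2)" for j
  have "uniform_limit {0..pi} (\<lambda>n \<theta>. \<Sum>j<n. b j * cos (real j * \<theta>))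
      (\<lambda>\<theta>. \<Sum>j. b j * cos (real j * \<theta>)) sequentially"
  proof (rule Weierstrass_m_test)
    show "norm (b j * cos (real j * \<theta>)) \<le> 2 * \<bar>bessel_I j (- \<tau> / 2)\<bar>" for j \<theta>
      using mult_mono[of "\<bar>b j\<bar>" "2 * \<bar>bessel_I j (- \<tau> / 2)\<bar>" "\<bar>cos (real j * \<theta>)\<bar>" 1]
      by (auto simp: b_def abs_mult)
  qed (intro summable_mult summable_abs_bessel_I)
  moreover have "(\<Sum>j. b j * cos (real j * \<theta>)) = exp (- \<tau> * cos \<theta>)" for \<theta>
    using jacobi_anger[of "- \<tau> / 2" \<theta>] by (simp add: b_def sums_iff mult.assoc)
  ultimately have u: "uniform_limit {0..pi} (\<lambda>n \<theta>. \<Sum>j<n. b j * cos (real j * \<theta>))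
      (\<lambda>\<theta>. exp (- \<tau> * cos \<theta>)) sequentially"
    by simp
  have "uniform_limit {0..pi} (\<lambda>n \<theta>. cos (real k * \<theta>) * (\<Sum>j<n. b j * cos (real j * \<theta>)))
      (\<lambda>\<theta>. cos (real k * \<theta>) * exp (- \<tau> * cos \<theta>)) sequentially"
  proof (rule uniform_lim_mult[OF uniform_limit_const u])
    show "bounded ((\<lambda>\<theta>. cos (real k * \<theta>)) ` {0..pi})"
      by (intro boundedI[where B = 1]) auto
    show "bounded ((\<lambda>\<theta>. exp (- \<tau> * cos \<theta>)) ` {0..pi})"
      by (intro compact_imp_bounded compact_continuous_image continuous_intros) auto
  qed
  then obtain I J where I: "\<And>n. ((\<lambda>\<theta>. cos (real k * \<theta>) * (\<Sum>j<n. b j * cos (real j * \<theta>))) has_integral I n) {0..pi}"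
    and J: "((\<lambda>\<theta>. cos (real k * \<theta>) * exp (- \<tau> * cos \<theta>)) has_integral J) {0..pi}"
    and IJ: "I \<longlonglongrightarrow> J"
    by (rule uniform_limit_integral) (auto intro!: continuous_intros)
  \<comment> \<open>Once \<open>n > k\<close> the partial sum contains the term
    \<open>j = k\<close>, so the integrals are eventually constant.\<close>
  have "I n = pi * bessel_I k (- \<tau> / 2)" if "n > k" for n
  proof -
    have "((\<lambda>\<theta>. \<Sum>j<n. b j * (cos (real j * \<theta>) * cos (real k * \<theta>))) has_integral
        (\<Sum>j<n. b j * (if j = k then (if k = 0 then pi else pi / 2) else 0))) {0..pi}"
      by (intro has_integral_sum has_integral_mult_right has_integral_cos_cos) auto
    also have "(\<lambda>\<theta>. \<Sum>j<n. b j * (cos (real j * \<theta>) * cos (real k * \<theta>)))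
        = (\<lambda>\<theta>. cos (real k * \<theta>) * (\<Sum>j<n. b j * cos (real j * \<theta>)))"
      by (simp add: sum_distrib_left mult_ac)
    finally have "I n = (\<Sum>j<n. b j * (if j = k then (if k = 0 then pi else pi / 2) else 0))"
      using I has_integral_unique by blast
    \<comment> \<open>Weight 1 with integral \<open>pi\<close> at \<open>k = 0\<close> and weight 2
      with integral \<open>pi / 2\<close> otherwise both give \<open>pi\<close>.\<close>
    also have "\<dots> = (\<Sum>j<n. if j = k then pi * bessel_I k (- \<tau> / 2) else 0)"
      by (intro sum.cong) (auto simp: b_def)
    finally show ?thesis using that by simp
  qed
  then have "I \<longlonglongrightarrow> pi * bessel_I k (- \<tau> / 2)"
    by (intro tendsto_eventually eventually_sequentiallyI[of "Suc k"]) auto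
  from IJ this have "J = pi * bessel_I k (- \<tau> / 2)" using LIMSEQ_unique by blast
  have "exp (-\<tau>) * (cos (real k * \<theta>) * exp (- \<tau> * cos \<theta>))
      = cos (real k * \<theta>) * exp (- \<tau> * (cos \<theta> + 1))" for \<theta>
    by (simp add: algebra_simps flip: exp_add)
  with has_integral_mult_right[OF J, of "exp (-\<tau>)"] \<open>J = _\<close>
  have "((\<lambda>\<theta>. cos (real k * \<theta>) * exp (- \<tau> * (cos \<theta> + 1))) has_integral
      exp (-\<tau>) * (pi * bessel_I k (- \<tau> / 2))) {0..pi}"
    by (simp only:)
  then show ?thesis
    unfolding cheb_coeff_def by (simp add: integral_unique)
qed

section \<open>Truncation error of the Chebyshev approximation\<close>

text \<open>Halving the zeroth coefficient matches the weight 1 in the Jacobi-Anger series, so the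
  approximation error is \<open>exp (-\<tau>)\<close> times a tail of that series.\<close>

lemma cheb_approx_cos:
  "cheb_approx K \<tau> (1 + cos \<theta>) = exp (-\<tau>) *
     (\<Sum>k<Suc K. (if k = 0 then 1 else 2) * (bessel_I k (- \<tau> / 2) * cos (real k * \<theta>)))"
proof -
  have "(\<Sum>k<Suc K. (if k = 0 then 1 else 2) * (bessel_I k (- \<tau> / 2) * cos (real k * \<theta>)))
      = bessel_I 0 (- \<tau> / 2) + (\<Sum>k=1..K. 2 * (bessel_I k (- \<tau> / 2) * cos (real k * \<theta>)))"
    unfolding lessThan_Suc_atMost atMost_atLeast0
    by (subst sum.atLeast_Suc_atMost) auto
  then show ?thesis
    by (simp add: cheb_approx_def poly_chebyshev_poly_cos cheb_coeff_eq distrib_left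
        sum_distrib_left mult_ac)
qed

text \<open>The bound \<open>h < K + 1\<close> keeps the geometric ratio below 1, and
  \<open>(K + 1)! * (1 - h / (K + 1)) = K! * (K + 1 - h)\<close> yields the denominator of
  \<open>g_bound\<close>.\<close>

lemma sums_bessel_I_majorant:
  assumes "0 \<le> h" "h < real K + 1"
  shows "(\<lambda>i. h ^ Suc K / fact (Suc K) * (h / (real K + 1)) ^ i)
    sums (h ^ (K + 1) / (fact K * (real K + 1 - h)))"
proof -
  have "(\<lambda>i. h ^ Suc K / fact (Suc K) * (h / (real K + 1)) ^ i)
      sums (h ^ Suc K / fact (Suc K) * (1 / (1 - h / (real K + 1))))"
    using assms by (intro sums_mult geometric_sums) auto
  also have "h ^ Suc K / fact (Suc K) * (1 / (1 - h / (real K + 1)))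
      = h ^ (K + 1) / (fact K * (real K + 1 - h))"
    using assms by (simp add: divide_simps)
  finally show ?thesis .
qed

lemma cheb_approx_error:
  assumes "0 \<le> \<tau>" "real K > \<tau> / 2 - 1" "0 \<le> t" "t \<le> 2"
  shows "\<bar>exp (- \<tau> * t) - cheb_approx K \<tau> t\<bar> \<le> g_bound K \<tau>"
proof -
  \<comment> \<open>The substitution \<open>t = 1 + cos \<theta>\<close> needs \<open>t - 1\<close>
    in [-1, 1]; this is where the interval [0, 2] enters.\<close>
  define \<theta> where "\<theta> = arccos (t - 1)"
  define h where "h = \<tau> / 2"
  \<comment> \<open>The exponential factor of \<open>abs_bessel_I_le\<close> at the first omitted
    order \<open>K + 1\<close>, the largest in the tail.\<close>
  define E where "E = exp (h\<^sup>2 / (real K + 2))"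
  have h: "0 \<le> h" "h < real K + 1" using assms by (auto simp: h_def)
  have t: "t = 1 + cos \<theta>" using assms by (simp add: \<theta>_def)
  define f where "f k = (if k = 0 then 1 else 2) * (bessel_I k (- h) * cos (real k * \<theta>))" for k
  have le: "\<bar>f (i + Suc K)\<bar> \<le> 2 * E * (h ^ Suc K / fact (Suc K) * (h / (real K + 1)) ^ i)" for i
  proof -
    have "\<bar>f (i + Suc K)\<bar> \<le> 2 * \<bar>bessel_I (i + Suc K) (- h)\<bar>"
      using mult_left_mono[OF abs_cos_le_one, of "2 * \<bar>bessel_I (i + Suc K) (- h)\<bar>"]
      by (simp add: f_def abs_mult)
    also have "\<dots> \<le> 2 * (h ^ (i + Suc K) / fact (i + Suc K) * exp (h\<^sup>2 / (real (i + Suc K) + 1)))"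
      using abs_bessel_I_le[of "i + Suc K" "- h"] h by simp
    also have "\<dots> \<le> 2 * (h ^ (i + Suc K) / (fact (Suc K) * (real K + 1) ^ i) * E)"
    proof (intro mult_left_mono mult_mono divide_left_mono)
      \<comment> \<open>The factorial estimate offers the base \<open>K + 2\<close>; weakening it to
        \<open>K + 1\<close> gives the ratio \<open>h / (K + 1)\<close> behind
        \<open>g_bound\<close>.\<close>
      have "fact (Suc K) * (real K + 1) ^ i \<le> fact (Suc K) * (real (Suc K) + 1) ^ i"
        by (intro mult_left_mono power_mono) auto
      also have "\<dots> \<le> fact (i + Suc K)"
        by (rule fact_mult_power_le_fact_add)
      finally show "fact (Suc K) * (real K + 1) ^ i \<le> fact (i + Suc K)" .
      have "h\<^sup>2 / (real (i + Suc K) + 1) \<le> h\<^sup>2 / (real K + 2)"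
        by (intro divide_left_mono) auto
      then show "exp (h\<^sup>2 / (real (i + Suc K) + 1)) \<le> E"
        by (simp add: E_def)
    qed (use h in auto)
    also have "\<dots> = 2 * E * (h ^ Suc K / fact (Suc K) * (h / (real K + 1)) ^ i)"
      by (simp add: power_add power_divide)
    finally show ?thesis .
  qed
  have maj: "(\<lambda>i. 2 * E * (h ^ Suc K / fact (Suc K) * (h / (real K + 1)) ^ i))
      sums (2 * E * (h ^ (K + 1) / (fact K * (real K + 1 - h))))"
    by (intro sums_mult sums_bessel_I_majorant h)
  have "f sums exp (- \<tau> * cos \<theta>)"
    using jacobi_anger[of "- h" \<theta>] by (simp add: f_def[abs_def] h_def)
  from sums_split_initial_segment[OF this, of "Suc K"]
  have rest: "exp (- \<tau> * cos \<theta>) - (\<Sum>k<Suc K. f k) = (\<Sum>i. f (i + Suc K))"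
    by (simp only: sums_iff)
  have "exp (- \<tau> * t) - cheb_approx K \<tau> t
      = exp (-\<tau>) * (exp (- \<tau> * cos \<theta>) - (\<Sum>k<Suc K. f k))"
    unfolding t cheb_approx_cos by (simp add: f_def h_def algebra_simps flip: exp_add)
  also have "\<bar>\<dots>\<bar> = exp (-\<tau>) * \<bar>\<Sum>i. f (i + Suc K)\<bar>"
    by (simp only: rest abs_mult abs_exp_cancel)
  also have "\<dots> \<le> exp (-\<tau>) * (2 * E * (h ^ (K + 1) / (fact K * (real K + 1 - h))))"
  proof (intro mult_left_mono)
    have s: "summable (\<lambda>i. \<bar>f (i + Suc K)\<bar>)"
      by (rule summable_comparison_test'[OF sums_summable[OF maj], of 0]) (use le in auto)
    have "\<bar>\<Sum>i. f (i + Suc K)\<bar> \<le> (\<Sum>i. \<bar>f (i + Suc K)\<bar>)"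
      by (rule summable_rabs[OF s])
    also have "\<dots> \<le> 2 * E * (h ^ (K + 1) / (fact K * (real K + 1 - h)))"
      using suminf_le[OF le s sums_summable[OF maj]] sums_unique[OF maj] by simp
    finally show "\<bar>\<Sum>i. f (i + Suc K)\<bar> \<le> 2 * E * (h ^ (K + 1) / (fact K * (real K + 1 - h)))" .
  qed simp
  also have "\<dots> = g_bound K \<tau>"
  proof -
    have "exp (-\<tau>) * (2 * exp a * c) = 2 * exp (a - \<tau>) * c" for a c
      by (simp add: exp_diff exp_minus divide_inverse)
    then show ?thesis by (simp only: g_bound_def E_def h_def)
  qed
  finally show ?thesis .
qed

section \<open>Functions of symmetric matrices\<close>

lemma quadratic_le_0_imp_linear_coeff_0:
  fixes a b :: real
  assumes le: "\<And>t. 2 * t * a + t\<^sup>2 * b \<le> 0"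
  shows "a = 0"
proof (rule ccontr)
  assume "a \<noteq> 0"
  \<comment> \<open>At \<open>t = a / c\<close> the quadratic equals
    \<open>(a / c)^2 * (2 * c + b)\<close>, positive unless \<open>a = 0\<close>.\<close>
  define c where "c = \<bar>b\<bar> + 1"
  have c: "0 < c" "0 < 2 * c + b" by (auto simp: c_def)
  have "(a / c)\<^sup>2 * (2 * c + b) = 2 * (a / c) * a + (a / c)\<^sup>2 * b"
    using c by (simp add: field_simps power2_eq_square)
  also have "\<dots> \<le> 0" by (rule le)
  finally show False
    using c \<open>a \<noteq> 0\<close> by (simp add: mult_le_0_iff)
qed

lemma inner_symmetric_matrix:
  fixes A :: "real^'n^'n"
  assumes "transpose A = A"
  shows "(A *v x) \<bullet> y = x \<bullet> (A *v y)"
  by (metis assms dot_lmul_matrix inner_commute transpose_matrix_vector)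

text \<open>The quadratic form attains its maximum on the compact unit sphere of \<open>S\<close>,
  and a maximizer is an eigenvector; invariance keeps its residual inside \<open>S\<close>.\<close>

lemma symmetric_matrix_eigenvector_in_subspace:
  fixes A :: "real^'n^'n"
  assumes sym: "transpose A = A" and S: "subspace S" "S \<noteq> {0}"
    and inv: "\<And>x. x \<in> S \<Longrightarrow> A *v x \<in> S"
  shows "\<exists>u l. u \<in> S \<and> norm u = 1 \<and> A *v u = l *\<^sub>R u"
proof -
  define q where "q x = x \<bullet> (A *v x)" for x
  obtain v where v: "v \<in> S" "v \<noteq> 0" using S subspace_0 by blast
  have "compact (S \<inter> sphere 0 1)"
    by (intro closed_Int_compact closed_subspace S compact_sphere)
  moreover have "v /\<^sub>R norm v \<in> S \<inter> sphere 0 1"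
    using v S by (auto intro: subspace_scale)
  moreover have "continuous_on (S \<inter> sphere 0 1) q"
    unfolding q_def by (intro continuous_intros)
  ultimately obtain u where u: "u \<in> S" "norm u = 1"
    and max: "\<And>y. y \<in> S \<Longrightarrow> norm y = 1 \<Longrightarrow> q y \<le> q u"
    using continuous_attains_sup[of "S \<inter> sphere 0 1" q] by fastforce
  define l where "l = q u"
  have q_le: "q y \<le> l * (norm y)\<^sup>2" if "y \<in> S" for y
  proof (cases "y = 0")
    case False
    have "q (y /\<^sub>R norm y) \<le> l"
      unfolding l_def using False that S by (intro max) (auto intro: subspace_scale)
    moreover have "q (y /\<^sub>R norm y) = q y / (norm y)\<^sup>2"
      by (simp add: q_def matrix_vector_mult_scaleR power2_eq_square divide_inverse)
    ultimately show ?thesis using False by (simp add: divide_le_eq)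
  qed (simp add: q_def)
  (* Perturbing the maximizer u in the direction of its own residual w forces w = 0. *)
  define w where "w = A *v u - l *\<^sub>R u"
  have w: "w \<in> S" unfolding w_def using S u inv by (intro subspace_diff subspace_scale)
  \<comment> \<open>This is \<open>q_le\<close> at \<open>u + t w\<close>, expanded in
    \<open>t\<close>: the constant terms cancel and the linear part reduces to
    \<open>w \<bullet> w\<close>.\<close>
  have "2 * t * (w \<bullet> w) + t\<^sup>2 * (q w - l * (w \<bullet> w)) \<le> 0" for t
  proof -
    have "q (u + t *\<^sub>R w) \<le> l * (norm (u + t *\<^sub>R w))\<^sup>2"
      using S u w by (intro q_le subspace_add subspace_scale)
    moreover have "q (u + t *\<^sub>R w) = l + 2 * t * (w \<bullet> (A *v u)) + t\<^sup>2 * q w"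
      using inner_symmetric_matrix[OF sym, of u w]
      by (simp add: q_def l_def matrix_vector_right_distrib matrix_vector_mult_scaleR
          inner_add_left inner_add_right power2_eq_square algebra_simps inner_commute)
    moreover have "(norm (u + t *\<^sub>R w))\<^sup>2 = 1 + 2 * t * (w \<bullet> u) + t\<^sup>2 * (w \<bullet> w)"
      using u(2) unfolding norm_eq_1
      unfolding power2_norm_eq_inner
      by (simp add: inner_add_left inner_add_right power2_eq_square
          algebra_simps inner_commute)
    moreover have "w \<bullet> (A *v u) - l * (w \<bullet> u) = w \<bullet> w"
      by (simp add: w_def inner_diff_right inner_diff_left algebra_simps)
    ultimately show ?thesis by (simp add: algebra_simps)
  qed
  then have "w \<bullet> w = 0"
    by (rule quadratic_le_0_imp_linear_coeff_0)
  then have "A *v u = l *\<^sub>R u" by (simp add: w_def)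
  with u show ?thesis by blast
qed

text \<open>Take an orthonormal set of eigenvectors of maximal cardinality. Its orthogonal
  complement is invariant, so a nonzero complement would contain one more eigenvector.\<close>

theorem symmetric_matrix_diagonalizable:
  fixes A :: "real^'n^'n"
  assumes sym: "transpose A = A"
  shows "\<exists>U d. orthogonal_matrix U \<and> A = U ** diag_matrix d ** transpose U"
proof -
  define P where "P B \<longleftrightarrow> pairwise orthogonal B \<and> (\<forall>u\<in>B. norm u = 1 \<and> (\<exists>l. A *v u = l *\<^sub>R u))"
    for B :: "(real^'n) set"
  have P_card: "independent B \<and> finite B \<and> card B \<le> CARD('n)" if "P B" for B
  proof -
    have "independent B"
      using that by (intro pairwise_orthogonal_independent) (auto simp: P_def)
    then show ?thesis using independent_bound[of B] by simp
  qed
  have "P {}" by (simp add: P_def)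
  then obtain B where B: "P B" and max: "\<And>C. P C \<Longrightarrow> card C \<le> card B"
    using ex_has_greatest_nat[of P "{}" card "CARD('n)"] P_card by fastforce
  define S where "S = {y. \<forall>x\<in>B. orthogonal x y}"
  have "S = {0}"
  proof (rule ccontr)
    assume "S \<noteq> {0}"
    moreover have "A *v x \<in> S" if "x \<in> S" for x
    proof -
      have "u \<bullet> (A *v x) = 0" if "u \<in> B" for u
      proof -
        obtain l where "A *v u = l *\<^sub>R u" using B \<open>u \<in> B\<close> by (auto simp: P_def)
        then show ?thesis
          using inner_symmetric_matrix[OF sym, of u x] \<open>x \<in> S\<close> \<open>u \<in> B\<close>
          by (simp add: S_def orthogonal_def)
      qed
      then show ?thesis by (simp add: S_def orthogonal_def)
    qed
    moreover have "subspace S"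
      unfolding S_def by (rule subspace_orthogonal_to_vectors)
    ultimately obtain u l where u: "u \<in> S" "norm u = 1" "A *v u = l *\<^sub>R u"
      using symmetric_matrix_eigenvector_in_subspace[OF sym] by blast
    have "u \<notin> B" using u by (auto simp: S_def orthogonal_def norm_eq_1)
    moreover have "P (insert u B)"
      using B u by (auto simp: P_def S_def intro!: pairwise_orthogonal_insert) (metis orthogonal_commute)
    ultimately show False using max[of "insert u B"] P_card[OF B] by simp
  qed
  have "span B = UNIV"
  proof (rule ccontr)
    assume "span B \<noteq> UNIV"
    then have "span B \<subset> span UNIV" by auto
    then obtain y where "y \<noteq> 0" "\<And>x. x \<in> span B \<Longrightarrow> orthogonal y x"
      using orthogonal_to_subspace_exists_gen[of B UNIV] by blast
    then have "y \<in> S" by (auto simp: S_def orthogonal_commute span_base)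
    with \<open>S = {0}\<close> \<open>y \<noteq> 0\<close> show False by simp
  qed
  then have "card B = CARD('n)"
    using P_card[OF B] dim_span[of B] by (simp add: dim_eq_card_independent)
  then obtain f where f: "bij_betw f (UNIV :: 'n set) B"
    using P_card[OF B] finite_same_card_bij[of "UNIV :: 'n set" B] by auto
  define U :: "real^'n^'n" where "U = (\<chi> i j. f j $ i)"
  have col: "column j U = f j" for j by (simp add: U_def column_def vec_eq_iff)
  have fB: "f j \<in> B" for j using f by (auto simp: bij_betw_def)
  have U: "orthogonal_matrix U"
    unfolding orthogonal_matrix_orthonormal_columns col
    using B fB bij_betw_imp_inj_on[OF f] unfolding P_def pairwise_def inj_on_def by blast
  have "\<exists>l. A *v f j = l *\<^sub>R f j" for j using B fB by (auto simp: P_def)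
  then obtain d where d: "\<And>j. A *v f j = d j *\<^sub>R f j" by metis
  have "(A ** U) $ i $ j = (U ** diag_matrix d) $ i $ j" for i j
    using arg_cong[OF d[of j], of "\<lambda>v. v $ i"]
    unfolding matrix_mul_diag_matrix
    by (simp add: matrix_matrix_mult_def matrix_vector_mult_def U_def mult.commute)
  then have "A ** U = U ** diag_matrix d" by (simp add: vec_eq_iff)
  then have "A = U ** diag_matrix d ** transpose U"
    using U by (metis matrix_mul_assoc matrix_mul_rid orthogonal_matrix_def)
  with U show ?thesis by blast
qed

section \<open>Spectral action and norm bounds of matrix functions\<close>

lemma diag_matrix_mult_vec: "(diag_matrix d *v y) $ i = d i * y $ i"
  by (simp add: matrix_vector_mult_def diag_matrix_def mult_delta_left)

text \<open>The eigenvector is the \<open>i\<close>-th column of \<open>U\<close>. Bounds known for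
  eigenvalues thereby transfer to the diagonal entries.\<close>

lemma eigenvalue_of_diagonalization:
  fixes A :: "real^'n^'n"
  assumes U: "orthogonal_matrix U" and A: "A = U ** diag_matrix d ** transpose U"
  shows "eigenvalue_of A (d i)"
proof -
  have UU: "transpose U ** U = mat 1" using U by (simp add: orthogonal_matrix_def)
  have "A *v (U *v axis i 1) = U *v (diag_matrix d *v ((transpose U ** U) *v axis i 1))"
    by (simp add: A matrix_vector_mul_assoc matrix_mul_assoc)
  also have "diag_matrix d *v ((transpose U ** U) *v axis i 1) = d i *\<^sub>R axis i 1"
    by (simp add: UU vec_eq_iff diag_matrix_mult_vec axis_def)
  finally have "A *v (U *v axis i 1) = d i *\<^sub>R (U *v axis i 1)"
    by (simp add: matrix_vector_mult_scaleR)
  moreover have "U *v axis i 1 \<noteq> 0"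
  proof
    assume "U *v axis i 1 = 0"
    then have "(transpose U ** U) *v axis i 1 = 0"
      by (simp flip: matrix_vector_mul_assoc)
    then show False by (simp add: UU axis_eq_0_iff)
  qed
  ultimately show ?thesis unfolding eigenvalue_of_def by blast
qed

text \<open>In the coordinates \<open>y\<close> given by \<open>U\<close>, an entry
  \<open>y $ i\<close> is nonzero only where \<open>d i = l\<close>, so \<open>f (d i)\<close> acts
  there as \<open>f l\<close>.\<close>

lemma matrix_function_eigenvector:
  fixes A :: "real^'n^'n"
  assumes sym: "transpose A = A" and v: "A *v v = l *\<^sub>R v"
  shows "matrix_function f A *v v = f l *\<^sub>R v"
proof -
  obtain U d where U: "orthogonal_matrix U" and A: "A = U ** diag_matrix d ** transpose U"
    using symmetric_matrix_diagonalizable[OF sym] by blast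
  have UU: "transpose U ** U = mat 1" "U ** transpose U = mat 1"
    using U by (auto simp: orthogonal_matrix_def)
  define y where "y = transpose U *v v"
  have "diag_matrix d *v y = (transpose U ** U) *v (diag_matrix d *v y)"
    by (simp add: UU)
  also have "\<dots> = transpose U *v (A *v v)"
    by (simp add: A y_def matrix_vector_mul_assoc matrix_mul_assoc del: transpose_matrix_vector)
  also have "\<dots> = l *\<^sub>R y"
    by (simp add: v y_def matrix_vector_mult_scaleR)
  finally have dy: "d i * y $ i = l * y $ i" for i
    by (metis diag_matrix_mult_vec vector_scaleR_component real_scaleR_def)
  then have fy: "diag_matrix (\<lambda>i. f (d i)) *v y = f l *\<^sub>R y"
    by (auto simp: vec_eq_iff diag_matrix_mult_vec)
  have "matrix_function f A *v v = U *v (diag_matrix (\<lambda>i. f (d i)) *v y)"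
    by (simp add: matrix_function_eqI[OF U A] y_def matrix_vector_mul_assoc matrix_mul_assoc del: transpose_matrix_vector)
  also have "\<dots> = f l *\<^sub>R ((U ** transpose U) *v v)"
    unfolding fy by (simp only: matrix_vector_mult_scaleR y_def matrix_vector_mul_assoc)
  finally show ?thesis by (simp add: UU)
qed

lemma transpose_diag_matrix: "transpose (diag_matrix d) = diag_matrix d"
  by (auto simp: transpose_def diag_matrix_def vec_eq_iff)

lemma transpose_matrix_function:
  fixes A :: "real^'n^'n"
  assumes "transpose A = A"
  shows "transpose (matrix_function f A) = matrix_function f A"
proof -
  obtain U d where U: "orthogonal_matrix U" and A: "A = U ** diag_matrix d ** transpose U"
    using symmetric_matrix_diagonalizable[OF assms] by blast
  show ?thesis
    by (simp add: matrix_function_eqI[OF U A] matrix_transpose_mul transpose_diag_matrix matrix_mul_assoc)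
qed

lemma norm_orthogonal_matrix_vec:
  fixes U :: "real^'n^'n"
  assumes "orthogonal_matrix U"
  shows "norm (U *v x) = norm x"
  using assms orthogonal_transformation_matrix[of "(*v) U"]
  by (simp add: orthogonal_transformation_norm)

text \<open>In orthonormal eigencoordinates the difference is diagonal with entries at most
  \<open>c\<close> in modulus, and \<open>U\<close> is an isometry.\<close>

lemma norm_matrix_function_diff_le:
  fixes A :: "real^'n^'n"
  assumes sym: "transpose A = A"
    and le: "\<And>l. eigenvalue_of A l \<Longrightarrow> \<bar>f l - g l\<bar> \<le> c"
  shows "norm (matrix_function f A *v x - matrix_function g A *v x) \<le> c * norm x"
proof -
  obtain U d where U: "orthogonal_matrix U" and A: "A = U ** diag_matrix d ** transpose U"
    using symmetric_matrix_diagonalizable[OF sym] by blast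
  define y where "y = transpose U *v x"
  define z where "z = diag_matrix (\<lambda>i. f (d i)) *v y - diag_matrix (\<lambda>i. g (d i)) *v y"
  have d: "\<bar>f (d i) - g (d i)\<bar> \<le> c" for i
    by (intro le eigenvalue_of_diagonalization[OF U A])
  then have c: "0 \<le> c" using abs_ge_zero order_trans by blast
  have "matrix_function f A *v x - matrix_function g A *v x = U *v z"
    by (simp add: matrix_function_eqI[OF U A] z_def y_def matrix_vector_mult_diff_distrib
        matrix_vector_mul_assoc matrix_mul_assoc del: transpose_matrix_vector)
  then have "norm (matrix_function f A *v x - matrix_function g A *v x) = norm z"
    by (simp add: norm_orthogonal_matrix_vec[OF U])
  also have "\<dots> \<le> norm (c *\<^sub>R y)"
  proof (rule norm_le_componentwise_cart)
    show "norm (z $ i) \<le> norm ((c *\<^sub>R y) $ i)" for i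
      using mult_right_mono[OF d, of "\<bar>y $ i\<bar>" i] c
      by (simp add: z_def diag_matrix_mult_vec abs_mult flip: left_diff_distrib)
  qed
  also have "\<dots> = c * norm x"
    using U c by (simp add: y_def norm_orthogonal_matrix_vec del: transpose_matrix_vector)
  finally show ?thesis .
qed

section \<open>Spectrum of the graph Laplacian and conservation of the entry sum\<close>

text \<open>In terms of differences, both the quadratic form and the vanishing on constants can be
  read off.\<close>

lemma laplacian_mult_vec:
  "(laplacian W *v v) $ i = (\<Sum>j\<in>UNIV. W $ i $ j * (v $ i - v $ j))"
proof -
  have "laplacian W *v v = diag_matrix (\<lambda>i. \<Sum>j\<in>UNIV. W $ i $ j) *v v - W *v v"
    by (simp add: laplacian_def matrix_vector_mult_diff_rdistrib)
  then show ?thesis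
    by (simp add: diag_matrix_mult_vec matrix_vector_mult_def[of W] sum_distrib_right
        right_diff_distrib sum_subtractf)
qed

lemma transpose_laplacian:
  assumes "weight_matrix W"
  shows "transpose (laplacian W) = laplacian W"
  using assms by (auto simp: weight_matrix_def laplacian_def transpose_def diag_matrix_def vec_eq_iff)

text \<open>Swapping \<open>i\<close> and \<open>j\<close> under symmetric weights gives a second
  expression for the form; adding the two produces the squares.\<close>

lemma laplacian_quadratic_form:
  assumes "weight_matrix W"
  shows "2 * (v \<bullet> (laplacian W *v v)) = (\<Sum>i\<in>UNIV. \<Sum>j\<in>UNIV. W $ i $ j * (v $ i - v $ j)\<^sup>2)"
proof -
  have W: "W $ j $ i = W $ i $ j" for i j
    using assms by (auto simp: weight_matrix_def transpose_def vec_eq_iff)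
  have 1: "v \<bullet> (laplacian W *v v) = (\<Sum>i\<in>UNIV. \<Sum>j\<in>UNIV. W $ i $ j * (v $ i - v $ j) * v $ i)"
    by (simp add: inner_vec_def laplacian_mult_vec sum_distrib_left mult_ac)
  also have "\<dots> = (\<Sum>i\<in>UNIV. \<Sum>j\<in>UNIV. W $ i $ j * (v $ j - v $ i) * v $ j)"
    by (subst sum.swap) (simp add: W)
  finally have "2 * (v \<bullet> (laplacian W *v v))
      = (\<Sum>i\<in>UNIV. \<Sum>j\<in>UNIV. W $ i $ j * (v $ i - v $ j) * v $ i)
      + (\<Sum>i\<in>UNIV. \<Sum>j\<in>UNIV. W $ i $ j * (v $ j - v $ i) * v $ j)"
    using 1 by simp
  also have "\<dots> = (\<Sum>i\<in>UNIV. \<Sum>j\<in>UNIV. W $ i $ j * (v $ i - v $ j)\<^sup>2)"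
    by (simp add: power2_eq_square algebra_simps flip: sum.distrib)
  finally show ?thesis .
qed

text \<open>With largest eigenvalue 2, this places the spectrum in [0, 2], where
  \<open>cheb_approx_error\<close> applies.\<close>

lemma laplacian_eigenvalue_nonneg:
  assumes W: "weight_matrix W" and l: "eigenvalue_of (laplacian W) l"
  shows "0 \<le> l"
proof -
  obtain v where v: "v \<noteq> 0" "laplacian W *v v = l *\<^sub>R v"
    using l by (auto simp: eigenvalue_of_def)
  have "0 \<le> 2 * (v \<bullet> (laplacian W *v v))"
    unfolding laplacian_quadratic_form[OF W]
    using W by (intro sum_nonneg mult_nonneg_nonneg) (auto simp: weight_matrix_def)
  then have "0 \<le> l * (v \<bullet> v)" by (simp add: v)
  moreover have "0 < v \<bullet> v" using v(1) by simp
  ultimately show ?thesis by (simp add: zero_le_mult_iff del: inner_gt_zero_iff)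
qed

lemma laplacian_mult_1: "laplacian W *v 1 = 0"
  by (simp add: vec_eq_iff laplacian_mult_vec)

text \<open>The entry sum is the inner product with the all-ones vector, which the symmetric matrix
  \<open>f(L)\<close> fixes because it has eigenvalue 0 and \<open>f 0 = 1\<close>.\<close>

lemma sum_matrix_function_laplacian:
  assumes "weight_matrix W" "f 0 = 1"
  shows "(\<Sum>i\<in>UNIV. (matrix_function f (laplacian W) *v x) $ i) = (\<Sum>i\<in>UNIV. x $ i)"
proof -
  have sym: "transpose (laplacian W) = laplacian W" by (rule transpose_laplacian) fact
  have "matrix_function f (laplacian W) *v 1 = 1"
    using matrix_function_eigenvector[OF sym, of 1 0 f] assms(2) by (simp add: laplacian_mult_1)
  then have "(matrix_function f (laplacian W) *v x) \<bullet> 1 = x \<bullet> 1"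
    using inner_symmetric_matrix[OF transpose_matrix_function[OF sym]] by metis
  then show ?thesis by (simp add: inner_vec_def)
qed

lemma sum_squared_le_card_norm_squared:
  fixes x :: "real^'n"
  shows "(\<Sum>i\<in>UNIV. x $ i)\<^sup>2 \<le> real CARD('n) * (norm x)\<^sup>2"
  using Cauchy_Schwarz_ineq[of x 1]
  by (simp add: inner_vec_def power2_norm_eq_inner mult.commute)

theorem mainTheorem4:
  fixes W L :: "real^'n^'n" and x :: "real^'n" and \<tau> a1 :: real and K :: nat
  assumes "0 \<le> \<tau>"
    and "weight_matrix W"
    and "L = laplacian W"
    and "largest_eigenvalue_of L 2"
    and "a1 = (\<Sum>i\<in>UNIV. x $ i)"
    and "a1 \<noteq> 0"
    and "real K > \<tau> / 2 - 1"
  shows "err_output K \<tau> L x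
           \<le> err_input K \<tau> L x * ((norm x)\<^sup>2 / (a1\<^sup>2 / real CARD('n)))
       \<and> err_input K \<tau> L x * ((norm x)\<^sup>2 / (a1\<^sup>2 / real CARD('n)))
           \<le> (g_bound K \<tau>)\<^sup>2 * (real CARD('n) * (norm x)\<^sup>2 / a1\<^sup>2)"
proof -
  have L: "transpose L = L"
    using assms(2,3) by (simp add: transpose_laplacian)
  \<comment> \<open>The lower bound for the squared norm of the exact diffusion.\<close>
  define c where "c = a1\<^sup>2 / real CARD('n)"
  define E where "E = exact_diffusion \<tau> L x"
  define N where "N = norm (E - approx_diffusion K \<tau> L x)"
  have "0 < c" using assms(6) by (simp add: c_def)
  have "0 < norm x" using assms(5,6) by auto
  have "a1 = (\<Sum>i\<in>UNIV. E $ i)"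
    using sum_matrix_function_laplacian[OF assms(2), of "\<lambda>t. exp (- \<tau> * t)" x] assms(3,5)
    by (simp add: E_def exact_diffusion_def)
  then have "c \<le> (norm E)\<^sup>2"
    using sum_squared_le_card_norm_squared[of E] by (simp add: c_def divide_le_eq mult.commute)
  have "N \<le> g_bound K \<tau> * norm x"
    unfolding N_def E_def exact_diffusion_def approx_diffusion_def
  proof (rule norm_matrix_function_diff_le[OF L])
    fix l assume "eigenvalue_of L l"
    then have "0 \<le> l" "l \<le> 2"
      using laplacian_eigenvalue_nonneg[OF assms(2)] assms(3,4)
      by (auto simp: largest_eigenvalue_of_def)
    then show "\<bar>exp (- \<tau> * l) - cheb_approx K \<tau> l\<bar> \<le> g_bound K \<tau>"
      by (intro cheb_approx_error assms)
  qed
  then have N: "N\<^sup>2 \<le> (g_bound K \<tau> * norm x)\<^sup>2"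
    by (rule power_mono) (simp add: N_def)
  \<comment> \<open>The norm of \<open>x\<close> cancels: the first inequality then only compares
    denominators, the second only numerators.\<close>
  have mid: "err_input K \<tau> L x * ((norm x)\<^sup>2 / c) = N\<^sup>2 / c"
    using \<open>0 < norm x\<close> by (simp add: err_input_def N_def E_def)
  have "err_output K \<tau> L x \<le> N\<^sup>2 / c"
    unfolding err_output_def E_def[symmetric] N_def[symmetric]
    by (rule frac_le[OF zero_le_power2 order_refl \<open>0 < c\<close> \<open>c \<le> (norm E)\<^sup>2\<close>])
  moreover have "N\<^sup>2 / c \<le> (g_bound K \<tau> * norm x)\<^sup>2 / c"
    using N \<open>0 < c\<close> by (intro divide_right_mono) auto
  moreover have "(g_bound K \<tau> * norm x)\<^sup>2 / c = (g_bound K \<tau>)\<^sup>2 * (real CARD('n) * (norm x)\<^sup>2 / a1\<^sup>2)"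
    by (simp add: c_def power_mult_distrib)
  ultimately show ?thesis
    by (simp only: mid flip: c_def)
qed

end
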